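(* Let $\psi:\mathbb{R}^2\to\mathbb{R}$ be a smooth (nonsingular) lens potential such that $T_{\mathbf y}(\mathbf x)=\tfrac12|\mathbf x-\mathbf y|^2-\psi(\mathbf x)$ is isolated for every non-caustic $\mathbf y$, and let $\boldsymbol\eta(\mathbf x)=\mathbf x-\nabla\psi(\mathbf x)$. Then: (1) If some non-caustic $\mathbf y$ has more than one lensed image, then it has at least $3$ images and there is $\mathbf x_0\in\mathbb{R}^2$ with $\det[\mathrm{Hess}\,T_{\mathbf y}](\mathbf x_0)<0$; conversely, if $\det[\mathrm{Hess}\,T_{\mathbf y}](\mathbf x_0)<0$ for some $\mathbf x_0$ and $\mathbf y_0=\boldsymbol\eta(\mathbf x_0)$ is non-caustic, then $\mathbf y_0$ has at least $3$ lensed images. (2) If there is $\mathbf x_0$ with $\kappa(\mathbf x_0)>1$ and $\mathbf y_0=\boldsymbol\eta(\mathbf x_0)$ is non-caustic, then $\mathbf y_0$ has at least $3$ lensed images.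
   Context: Lensed images of $\mathbf y$ are the critical points of $T_{\mathbf y}$ (points of $\boldsymbol\eta^{-1}(\mathbf y)$); $\det[\mathrm{Hess}\,T_{\mathbf y}]=\det[\mathrm{Jac}\,\boldsymbol\eta]$ is independent of $\mathbf y$. Caustic points are $\boldsymbol\eta(\{\det[\mathrm{Jac}\,\boldsymbol\eta]=0\})$. $\kappa=\tfrac12\nabla^2\psi$ is the surface mass density and $\Gamma^2=\tfrac14(\psi_{uu}-\psi_{vv})^2+\psi_{uv}^2$. $T_{\mathbf y}$ is isolated if $T_{\mathbf y}(\mathbf x)\to\infty$ as $|\mathbf x|\to\infty$ and the eigenvalues $1-\kappa\pm\Gamma$ of $\mathrm{Hess}\,T_{\mathbf y}(\mathbf x)$ are positive for $|\mathbf x|$ sufficiently large. *)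

theory Defs
  imports "HOL-Analysis.Analysis"
begin

type_synonym pt = "real ^ 2"

definition pd :: "(pt \<Rightarrow> real) \<Rightarrow> 2 \<Rightarrow> pt \<Rightarrow> real" where
  "pd f i x = frechet_derivative f (at x) (axis i 1)"

coinductive smooth2 :: "(pt \<Rightarrow> real) \<Rightarrow> bool" where
  "(\<forall>x. f differentiable (at x)) \<Longrightarrow> (\<forall>i. smooth2 (pd f i)) \<Longrightarrow> smooth2 f"

definition grad :: "(pt \<Rightarrow> real) \<Rightarrow> pt \<Rightarrow> pt" where
  "grad f x = (\<chi> i. pd f i x)"

definition hess :: "(pt \<Rightarrow> real) \<Rightarrow> pt \<Rightarrow> real ^ 2 ^ 2" where
  "hess f x = (\<chi> i j. pd (pd f j) i x)"

definition jac :: "(pt \<Rightarrow> pt) \<Rightarrow> pt \<Rightarrow> real ^ 2 ^ 2" where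
  "jac F x = matrix (frechet_derivative F (at x))"

definition Tdelay :: "(pt \<Rightarrow> real) \<Rightarrow> pt \<Rightarrow> pt \<Rightarrow> real" where
  "Tdelay psi y x = (1/2) * (norm (x - y))^2 - psi x"

definition lensmap :: "(pt \<Rightarrow> real) \<Rightarrow> pt \<Rightarrow> pt" where
  "lensmap psi x = x - grad psi x"

definition images :: "(pt \<Rightarrow> real) \<Rightarrow> pt \<Rightarrow> pt set" where
  "images psi y = {x. grad (Tdelay psi y) x = 0}"

definition caustic :: "(pt \<Rightarrow> real) \<Rightarrow> pt \<Rightarrow> bool" where
  "caustic psi y \<longleftrightarrow> y \<in> lensmap psi ` {x. det (jac (lensmap psi) x) = 0}"

definition kappa :: "(pt \<Rightarrow> real) \<Rightarrow> pt \<Rightarrow> real" where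
  "kappa psi x = (1/2) * (pd (pd psi 1) 1 x + pd (pd psi 2) 2 x)"

definition Gamma2 :: "(pt \<Rightarrow> real) \<Rightarrow> pt \<Rightarrow> real" where
  "Gamma2 psi x = (1/4) * (pd (pd psi 1) 1 x - pd (pd psi 2) 2 x)^2 + (pd (pd psi 2) 1 x)^2"

definition isolated_td :: "(pt \<Rightarrow> real) \<Rightarrow> pt \<Rightarrow> bool" where
  "isolated_td psi y \<longleftrightarrow>
     filterlim (Tdelay psi y) at_top at_infinity \<and>
     (\<exists>R. \<forall>x. norm x \<ge> R \<longrightarrow>
        1 - kappa psi x + sqrt (Gamma2 psi x) > 0 \<and> 1 - kappa psi x - sqrt (Gamma2 psi x) > 0)"

definition at_least_three :: "'a set \<Rightarrow> bool" where
  "at_least_three S \<longleftrightarrow> (\<exists>A. A \<subseteq> S \<and> card A = 3)"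

end

theory Submission
  imports Defs
begin

text \<open>
  The images of a non-caustic \<open>y\<close> are the zeros of \<open>F = lensmap psi - y\<close>, the gradient of the time
  delay \<open>T\<close>. Since \<open>T\<close> tends to infinity and is convex along rays far out, \<open>F\<close> points outwards on
  large circles, so the signs of its Jacobian determinant at the zeros add up to 1. Hence the
  number of images is \<open>2 s + 1\<close>, where \<open>s\<close> counts the saddles, which settles everything except for
  a maximum in (2); there a global minimum of \<open>T\<close> is a second image.

  The sum of signs is computed without cutting out discs: dividing \<open>F\<close>, as a complex number, by
  the product of its linearizations at the zeros leaves a function that extends continuously and
  without zeros to the disc. It therefore has a continuous logarithm and degree 0 on the circle,
  while each linearization has degree 1 or -1 and \<open>F\<close> itself has degree 1.
\<close>

section \<open>Zeros of outward-pointing plane fields\<close>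

text \<open>The winding number about 0, encoded by a factorization into a power of \<open>z\<close>
  and a function with a continuous logarithm. In this form degrees add under products. It is a
  relation, so uniqueness of \<open>k\<close> is a separate fact.\<close>

definition circle_degree :: "real \<Rightarrow> (complex \<Rightarrow> complex) \<Rightarrow> int \<Rightarrow> bool" where
  "circle_degree R f k \<longleftrightarrow>
     (\<exists>h. continuous_on (sphere 0 R) h \<and> (\<forall>z\<in>sphere 0 R. f z = z powi k * exp (h z)))"

text \<open>The values of \<open>u\<close> lie in the integer multiples of 2 \<pi>
  \<open>\<i>\<close>, a set with gaps of length \<open>2*pi\<close>, so continuity on a connected
  set leaves only one value.\<close>

lemma continuous_exp_eq_1_constant:
  fixes u :: "'a::topological_space \<Rightarrow> complex"
  assumes "connected S" and cont: "continuous_on S u" and exp: "\<And>t. t \<in> S \<Longrightarrow> exp (u t) = 1"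
  shows "u constant_on S"
proof (rule continuous_discrete_range_constant[OF assms(1) cont])
  fix x assume x: "x \<in> S"
  show "\<exists>e>0. \<forall>y. y \<in> S \<and> u y \<noteq> u x \<longrightarrow> e \<le> norm (u y - u x)"
  proof (intro exI[of _ "2*pi"] conjI allI impI)
    fix y assume y: "y \<in> S \<and> u y \<noteq> u x"
    then have "exp (u y) = exp (u x)" using exp x by simp
    then obtain n :: int where n: "u y = u x + (of_int (2 * n) * pi) * \<i>"
      by (auto simp: exp_eq)
    with y have "n \<noteq> 0" by auto
    then have "1 \<le> \<bar>real_of_int n\<bar>" by linarith
    moreover have "norm (u y - u x) = 2 * pi * \<bar>real_of_int n\<bar>"
      using n by (simp add: norm_mult)
    ultimately show "2*pi \<le> norm (u y - u x)" by simp
  qed simp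
qed

text \<open>Along one turn of the circle the two factorizations differ by a continuous logarithm of
  1, which is constant. Its increment over the turn is also \<open>k - l\<close> times 2 \<pi>
  \<open>\<i>\<close>, because \<open>h\<close> and \<open>g\<close> return to their initial
  values.\<close>

lemma circle_degree_unique:
  assumes R: "R > 0" and k: "circle_degree R f k" and l: "circle_degree R f l"
  shows "k = l"
proof -
  obtain h where h: "continuous_on (sphere 0 R) h" "\<And>z. z \<in> sphere 0 R \<Longrightarrow> f z = z powi k * exp (h z)"
    using k unfolding circle_degree_def by blast
  obtain g where g: "continuous_on (sphere 0 R) g" "\<And>z. z \<in> sphere 0 R \<Longrightarrow> f z = z powi l * exp (g z)"
    using l unfolding circle_degree_def by blast
  \<comment> \<open>Writing the radius as an exponential turns integer powers of \<open>e t\<close>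
    into exponentials of multiples of one continuous exponent, and \<open>u\<close> becomes a
    logarithm of the quotient of both factorizations.\<close>
  define e where "e t = exp (of_real (ln R) + \<i> * of_real t)" for t :: real
  define u where "u t = of_int (k - l) * (of_real (ln R) + \<i> * of_real t) + h (e t) - g (e t)" for t
  have e: "e t \<in> sphere 0 R" for t
    using R by (simp add: e_def)
  have ce: "continuous_on {0..2*pi} e"
    unfolding e_def by (intro continuous_intros)
  have powi_e: "e t powi m = exp (of_int m * (of_real (ln R) + \<i> * of_real t))" for t m
    unfolding e_def by (simp add: exp_power_int mult.commute)
  have "exp (u t) = 1" for t
  proof -
    have "e t powi k * exp (h (e t)) = e t powi l * exp (g (e t))"
      using h(2)[OF e] g(2)[OF e] by simp
    then have *: "exp (of_int k * (of_real (ln R) + \<i> * of_real t) + h (e t))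
        = exp (of_int l * (of_real (ln R) + \<i> * of_real t) + g (e t))"
      by (simp add: powi_e exp_add)
    have "u t = (of_int k * (of_real (ln R) + \<i> * of_real t) + h (e t))
        - (of_int l * (of_real (ln R) + \<i> * of_real t) + g (e t))"
      by (simp add: u_def algebra_simps)
    then show ?thesis using * by (simp only: exp_diff) simp
  qed
  moreover have "continuous_on {0..2*pi} u"
    unfolding u_def
    by (intro continuous_intros continuous_on_compose2[OF h(1) ce] continuous_on_compose2[OF g(1) ce])
       (use e in auto)
  ultimately have "u constant_on {0..2*pi}"
    by (intro continuous_exp_eq_1_constant) auto
  then obtain c where "\<And>t. t \<in> {0..2*pi} \<Longrightarrow> u t = c"
    unfolding constant_on_def by blast
  from this[of 0] this[of "2*pi"] have "u (2*pi) = u 0" by simp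
  moreover have "e (2*pi) = e 0"
    by (simp add: e_def exp_add mult.commute)
  ultimately have "of_int (k - l) * (\<i> * of_real (2*pi)) = (0::complex)"
    by (simp add: u_def algebra_simps)
  then show ?thesis by (simp del: of_int_diff)
qed

lemma circle_degree_cong:
  assumes "circle_degree R f k" "\<And>z. z \<in> sphere 0 R \<Longrightarrow> f z = g z" "k = l"
  shows "circle_degree R g l"
  using assms unfolding circle_degree_def by metis

lemma circle_degree_mult:
  assumes R: "R > 0" and k: "circle_degree R f k" and l: "circle_degree R g l"
  shows "circle_degree R (\<lambda>z. f z * g z) (k + l)"
proof -
  obtain h where h: "continuous_on (sphere 0 R) h" "\<And>z. z \<in> sphere 0 R \<Longrightarrow> f z = z powi k * exp (h z)"
    using k unfolding circle_degree_def by blast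
  obtain h' where h': "continuous_on (sphere 0 R) h'" "\<And>z. z \<in> sphere 0 R \<Longrightarrow> g z = z powi l * exp (h' z)"
    using l unfolding circle_degree_def by blast
  have "f z * g z = z powi (k + l) * exp (h z + h' z)" if "z \<in> sphere 0 R" for z
  proof -
    have "z \<noteq> 0" using that R by auto
    then show ?thesis using h(2)[OF that] h'(2)[OF that] by (simp add: power_int_add exp_add)
  qed
  then show ?thesis
    unfolding circle_degree_def using continuous_on_add[OF h(1) h'(1)] by blast
qed

lemma circle_degree_const: "c \<noteq> 0 \<Longrightarrow> circle_degree R (\<lambda>_. c) 0"
  unfolding circle_degree_def by (intro exI[of _ "\<lambda>_. Ln c"]) auto

lemma circle_degree_prod:
  assumes "R > 0" "finite A" "\<And>q. q \<in> A \<Longrightarrow> circle_degree R (f q) (k q)"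
  shows "circle_degree R (\<lambda>z. \<Prod>q\<in>A. f q z) (\<Sum>q\<in>A. k q)"
  using assms(2,3)
proof (induction A rule: finite_induct)
  case empty
  then show ?case by (simp add: circle_degree_const)
next
  case (insert q A)
  then show ?case by (simp add: circle_degree_mult[OF assms(1)])
qed

lemma circle_degree_ident: "circle_degree R (\<lambda>z. z) 1"
  unfolding circle_degree_def by (intro exI[of _ "\<lambda>_. 0"]) auto

text \<open>On the circle conjugation is \<open>R^2 / z\<close>, and the constant \<open>R^2\<close>
  is an exponential.\<close>

lemma circle_degree_cnj:
  assumes "R > 0"
  shows "circle_degree R cnj (- 1)"
proof -
  have "cnj z = z powi (- 1) * exp (of_real (ln (R^2)))" if "z \<in> sphere 0 R" for z
  proof -
    have "z \<noteq> 0" and "z * cnj z = of_real (R^2)"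
      using that assms by (auto simp: complex_norm_square[symmetric])
    then show ?thesis using assms by (simp add: field_simps exp_of_real power_int_minus flip: of_real_power)
  qed
  then show ?thesis
    unfolding circle_degree_def by (intro exI[of _ "\<lambda>_. of_real (ln (R^2))"]) auto
qed

text \<open>The right half plane avoids the branch cut of \<open>Ln\<close>, so \<open>Ln\<close>
  composed with \<open>f\<close> is a continuous logarithm.\<close>

lemma circle_degree_Re_pos:
  assumes "continuous_on (sphere 0 R) f" "\<And>z. z \<in> sphere 0 R \<Longrightarrow> Re (f z) > 0"
  shows "circle_degree R f 0"
proof -
  have "continuous_on (sphere 0 R) (\<lambda>z. Ln (f z))"
    by (rule continuous_on_Ln'[OF assms(1)]) (use assms(2) in \<open>force simp: complex_nonpos_Reals_iff\<close>)
  moreover have "f z = z powi 0 * exp (Ln (f z))" if "z \<in> sphere 0 R" for z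
    using assms(2)[OF that] by (subst exp_Ln) auto
  ultimately show ?thesis
    unfolding circle_degree_def by blast
qed

lemma circle_degree_near_1:
  assumes "continuous_on (sphere 0 R) f" "\<And>z. z \<in> sphere 0 R \<Longrightarrow> norm (f z) < 1"
  shows "circle_degree R (\<lambda>z. 1 + f z) 0"
proof (rule circle_degree_Re_pos)
  show "Re (1 + f z) > 0" if "z \<in> sphere 0 R" for z
    using assms(2)[OF that] abs_Re_le_cmod[of "f z"] by simp
qed (intro continuous_intros assms)

text \<open>A continuous function without zeros on the whole disc has a continuous logarithm there,
  which restricts to the circle.\<close>

lemma circle_degree_nonzero_on_cball:
  assumes "continuous_on (cball 0 R) f" "\<And>z. z \<in> cball 0 R \<Longrightarrow> f z \<noteq> 0"
  shows "circle_degree R f 0"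
proof -
  obtain h where "continuous_on (cball 0 R) h" "\<And>z. z \<in> cball 0 R \<Longrightarrow> f z = exp (h z)"
    using continuous_logarithm_on_cball[OF assms] by blast
  then show ?thesis
    unfolding circle_degree_def
    by (intro exI[of _ h]) (auto intro: continuous_on_subset)
qed

text \<open>The quotient \<open>f z / z\<close> is a positive multiple of
  \<open>f z * cnj z\<close>, so it has degree 0, and multiplying back by \<open>z\<close> adds
  1.\<close>

lemma circle_degree_outward:
  assumes R: "R > 0" and cont: "continuous_on (sphere 0 R) f"
    and out: "\<And>z. z \<in> sphere 0 R \<Longrightarrow> Re (f z * cnj z) > 0"
  shows "circle_degree R f 1"
proof -
  have nz: "z \<noteq> 0" if "z \<in> sphere 0 R" for z :: complex using R that by auto
  have "Re (f z / z) > 0" if "z \<in> sphere 0 R" for z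
    using out[OF that] nz[OF that] by (simp add: complex_div_cnj[of _ z])
  then have "circle_degree R (\<lambda>z. f z / z) 0"
    by (intro circle_degree_Re_pos continuous_intros cont) (use nz in auto)
  from circle_degree_mult[OF R circle_degree_ident this]
  show ?thesis
    by (rule circle_degree_cong) (use nz in auto)
qed

text \<open>The dominant one of the two terms is factored out. It contributes the degree of
  \<open>z\<close> or of \<open>cnj z\<close>; what remains is a nonzero constant and factors of the
  form 1 plus something of norm below 1, all of degree 0.\<close>

lemma circle_degree_affine:
  assumes p: "norm p < R" and ab: "norm a \<noteq> norm b"
  shows "circle_degree R (\<lambda>z. a * (z - p) + b * cnj (z - p)) (if norm b < norm a then 1 else -1)"
proof -
  have R: "R > 0" using p norm_ge_zero[of p] by linarith
  have nz: "z \<noteq> 0" and nzp: "z - p \<noteq> 0" if "z \<in> sphere 0 R" for z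
    using R p that by auto
  \<comment> \<open>Here \<open>p\<close> must lie strictly inside the circle: \<open>z - p\<close>
    is \<open>z\<close> times \<open>1 + - p / z\<close>, and the second factor then has degree
    0.\<close>
  have small: "norm (- p / z) < 1" if "z \<in> sphere 0 R" for z
    using that p R by (simp add: norm_divide)
  have shift: "circle_degree R (\<lambda>z. 1 + - p / z) 0"
    by (intro circle_degree_near_1 continuous_intros small) (use nz in auto)
  have shift': "circle_degree R (\<lambda>z. 1 + cnj (- p / z)) 0"
    by (intro circle_degree_near_1 continuous_intros) (use nz small in \<open>auto simp: norm_divide\<close>)
  show ?thesis
  proof (cases "norm b < norm a")
    case True
    then have a: "a \<noteq> 0" by auto
    have "circle_degree R (\<lambda>z. 1 + b / a * (cnj (z - p) / (z - p))) 0"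
      by (rule circle_degree_near_1, intro continuous_intros)
         (use nzp True a in \<open>auto simp: norm_mult norm_divide simp flip: complex_cnj_diff\<close>)
    from circle_degree_mult[OF R circle_degree_mult[OF R circle_degree_const[OF a] circle_degree_ident]
        circle_degree_mult[OF R shift this]]
    show ?thesis
      by (rule circle_degree_cong) (use True a nz nzp in \<open>auto simp: field_simps\<close>)
  next
    case False
    then have b: "b \<noteq> 0" and lt: "norm a < norm b" using ab by auto
    have "circle_degree R (\<lambda>z. 1 + a / b * ((z - p) / cnj (z - p))) 0"
      by (rule circle_degree_near_1, intro continuous_intros)
         (use nzp lt b in \<open>auto simp: norm_mult norm_divide simp flip: complex_cnj_diff\<close>)
    from circle_degree_mult[OF R circle_degree_mult[OF R circle_degree_const[OF b] circle_degree_cnj[OF R]]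
        circle_degree_mult[OF R shift' this]]
    show ?thesis
      by (rule circle_degree_cong) (use False b nz nzp in \<open>auto simp: field_simps\<close>)
  qed
qed

text \<open>Every real-linear map of the plane is \<open>w \<mapsto> a * w + b * cnj w\<close>, with
  determinant \<open>(norm a)\<^sup>2 - (norm b)\<^sup>2\<close>.\<close>

lemma norm_linear_cnj_lower_bound:
  "norm (a * w + b * cnj w) \<ge> \<bar>norm a - norm b\<bar> * norm w"
proof -
  have "norm (a * w + b * cnj w) \<ge> \<bar>norm (a * w) - norm (b * cnj w)\<bar>"
    using norm_triangle_ineq3[of "a * w" "- (b * cnj w)"] by simp
  then show ?thesis
    by (simp add: norm_mult abs_mult flip: left_diff_distrib)
qed

section \<open>Nondegenerate zeros and their linearizations\<close>

text \<open>The linearization is bounded below by a positive multiple of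
  \<open>norm (z - p)\<close>, so the remainder of first order approximation stays negligible after
  division by it.\<close>

lemma tendsto_quotient_derivative:
  assumes der: "(f has_derivative (\<lambda>w. a * w + b * cnj w)) (at p)"
    and ab: "norm a \<noteq> norm b" and fp: "f p = 0"
  shows "(\<lambda>z. f z / (a * (z - p) + b * cnj (z - p))) \<midarrow>p\<rightarrow> (1::complex)"
proof -
  define L where "L w = a * w + b * cnj w" for w
  define c where "c = \<bar>norm a - norm b\<bar>"
  have c: "c > 0" using ab by (simp add: c_def)
  have L: "norm (L w) \<ge> c * norm w" for w
    unfolding L_def c_def by (rule norm_linear_cnj_lower_bound)
  have "(\<lambda>z. norm (f z - f p - L (z - p)) / norm (z - p)) \<midarrow>p\<rightarrow> 0"
    using der unfolding has_derivative_def L_def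
    by (simp add: Lim_within divide_inverse mult.commute)
  then have lim: "(\<lambda>z. norm (f z - L (z - p)) / norm (z - p) / c) \<midarrow>p\<rightarrow> 0"
    using fp tendsto_divide_zero by fastforce
  have "(\<lambda>z. f z / L (z - p) - 1) \<midarrow>p\<rightarrow> 0"
  proof (rule Lim_null_comparison[OF _ lim])
    show "\<forall>\<^sub>F z in at p. norm (f z / L (z - p) - 1) \<le> norm (f z - L (z - p)) / norm (z - p) / c"
      unfolding eventually_at_filter
    proof (intro always_eventually allI impI)
      fix z assume "z \<noteq> p"
      then have pos: "c * norm (z - p) > 0" using c by simp
      then have "L (z - p) \<noteq> 0" using L[of "z - p"] by auto
      then have "norm (f z / L (z - p) - 1) = norm (f z - L (z - p)) / norm (L (z - p))"
        by (simp add: divide_simps flip: norm_divide)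
      also have "\<dots> \<le> norm (f z - L (z - p)) / (c * norm (z - p))"
        by (intro divide_left_mono L mult_pos_pos pos) (use pos L[of "z - p"] in auto)
      finally show "norm (f z / L (z - p) - 1) \<le> norm (f z - L (z - p)) / norm (z - p) / c"
        by (simp add: mult.commute)
    qed
  qed
  then show ?thesis
    unfolding L_def by (simp add: LIM_zero_iff)
qed

text \<open>Near a zero the quotient of \<open>f\<close> by its linearization is close to 1, so
  \<open>f\<close> has no other zero nearby. The compact zero set thus has no limit point in itself
  and is finite.\<close>

lemma finite_nondegenerate_zeros:
  assumes "compact K" and cont: "continuous_on K f"
    and der: "\<And>p. p \<in> K \<Longrightarrow> f p = 0 \<Longrightarrow> (f has_derivative (\<lambda>w. a p * w + b p * cnj w)) (at p)"
    and ab: "\<And>p. p \<in> K \<Longrightarrow> f p = 0 \<Longrightarrow> norm (a p) \<noteq> norm (b p)"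
  shows "finite {p \<in> K. f p = (0::complex)}"
proof -
  let ?Z = "{p \<in> K. f p = 0}"
  have comp: "compact ?Z"
  proof -
    have "closed ?Z"
      using continuous_closed_preimage_constant[OF cont compact_imp_closed[OF assms(1)]] by simp
    then have "compact (K \<inter> ?Z)" using assms(1) by (rule compact_Int_closed[rotated])
    then show ?thesis by (simp add: Int_absorb1 Collect_restrict)
  qed
  have "finite (?Z \<inter> ?Z)"
  proof (rule finite_not_islimpt_in_compact[OF comp])
    fix p assume p: "p \<in> ?Z"
    have "(\<lambda>z. f z / (a p * (z - p) + b p * cnj (z - p))) \<midarrow>p\<rightarrow> 1"
      by (rule tendsto_quotient_derivative) (use p der ab in auto)
    then have "\<forall>\<^sub>F z in at p. f z / (a p * (z - p) + b p * cnj (z - p)) \<noteq> 0"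
      by (rule tendsto_imp_eventually_ne) simp
    then have "\<forall>\<^sub>F z in at p. z \<notin> ?Z"
      by (rule eventually_mono) auto
    then show "\<not> p islimpt ?Z"
      by (simp add: islimpt_iff_eventually)
  qed
  then show ?thesis by simp
qed

section \<open>The index sum of an outward-pointing field\<close>

theorem sum_of_indices_eq_1:
  fixes f :: "complex \<Rightarrow> complex"
  assumes R: "R > 0" and cont: "continuous_on (cball 0 R) f"
    and out: "\<And>z. z \<in> sphere 0 R \<Longrightarrow> Re (f z * cnj z) > 0"
    and der: "\<And>p. p \<in> cball 0 R \<Longrightarrow> f p = 0 \<Longrightarrow> (f has_derivative (\<lambda>w. a p * w + b p * cnj w)) (at p)"
    and ab: "\<And>p. p \<in> cball 0 R \<Longrightarrow> f p = 0 \<Longrightarrow> norm (a p) \<noteq> norm (b p)"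
  shows "finite {p \<in> cball 0 R. f p = 0}"
    and "(\<Sum>p | p \<in> cball 0 R \<and> f p = 0. if norm (b p) < norm (a p) then 1 else -1) = (1::int)"
proof -
  define Z where "Z = {p \<in> cball 0 R. f p = 0}"
  show fin: "finite {p \<in> cball 0 R. f p = 0}"
    by (rule finite_nondegenerate_zeros[OF compact_cball cont der ab])
  then have finZ: "finite Z" by (simp add: Z_def)
  define L where "L q z = a q * (z - q) + b q * cnj (z - q)" for q z
  have L0: "L q z = 0 \<longleftrightarrow> z = q" if "q \<in> Z" for q z
    using norm_linear_cnj_lower_bound[of "a q" "b q" "z - q"] ab[of q] that
    by (auto simp: Z_def L_def mult_le_0_iff)
  have contL: "continuous_on S (L q)" for S q
    unfolding L_def by (intro continuous_intros)
  \<comment> \<open>A zero on the boundary circle would contradict the strict inequality in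
    \<open>out\<close>.\<close>
  have sphereZ: "norm q < R" if "q \<in> Z" for q
    using that out[of q] by (force simp: Z_def)
  \<comment> \<open>At a zero \<open>z\<close> the quotient of \<open>f\<close> by the whole product
    is replaced by its limit: \<open>f\<close> over the factor \<open>L z\<close> tends to 1, and
    only the other factors are left.\<close>
  define g where "g z = (if z \<in> Z then 1 / (\<Prod>q\<in>Z - {z}. L q z) else f z / (\<Prod>q\<in>Z. L q z))" for z
  have "continuous_on (cball 0 R) g"
    unfolding continuous_on_def
  proof (intro ballI)
    fix p :: complex assume p: "p \<in> cball 0 R"
    have L: "(L q \<longlongrightarrow> L q p) (at p within cball 0 R)" for q
      using contL[of "cball 0 R" q] p by (simp only: continuous_on_def)
    \<comment> \<open>A finite set has no limit points, so in punctured neighbourhoods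
      \<open>g\<close> is the plain quotient.\<close>
    have off_Z: "\<forall>\<^sub>F z in at p within cball 0 R. z \<notin> Z"
      using islimpt_finite[OF finZ, of p] filter_leD[OF at_le[OF subset_UNIV]]
      by (auto simp: islimpt_iff_eventually)
    show "(g \<longlongrightarrow> g p) (at p within cball 0 R)"
    proof (cases "p \<in> Z")
      case False
      have "((\<lambda>z. f z / (\<Prod>q\<in>Z. L q z)) \<longlongrightarrow> f p / (\<Prod>q\<in>Z. L q p)) (at p within cball 0 R)"
        using cont p finZ False L0 by (intro tendsto_intros L) (auto simp: continuous_on_def)
      with off_Z show ?thesis
        using False unfolding g_def
        by (simp, elim Lim_transform_eventually eventually_mono) auto
    next
      case True
      have "((\<lambda>z. f z / L p z) \<longlongrightarrow> 1) (at p within cball 0 R)"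
        unfolding L_def
        by (rule tendsto_within_subset[OF tendsto_quotient_derivative]) (use True der ab in \<open>auto simp: Z_def\<close>)
      then have "((\<lambda>z. f z / L p z * (1 / (\<Prod>q\<in>Z - {p}. L q z))) \<longlongrightarrow> 1 * (1 / (\<Prod>q\<in>Z - {p}. L q p)))
          (at p within cball 0 R)"
        using finZ L0 by (intro tendsto_intros L) auto
      moreover have "\<forall>\<^sub>F z in at p within cball 0 R. f z / L p z * (1 / (\<Prod>q\<in>Z - {p}. L q z)) = g z"
        using off_Z
      proof (rule eventually_mono)
        fix z assume "z \<notin> Z"
        then show "f z / L p z * (1 / (\<Prod>q\<in>Z - {p}. L q z)) = g z"
          using True finZ by (simp add: g_def prod.remove)
      qed
      ultimately have "(g \<longlongrightarrow> 1 * (1 / (\<Prod>q\<in>Z - {p}. L q p))) (at p within cball 0 R)"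
        by (rule Lim_transform_eventually)
      then show ?thesis using True by (simp add: g_def)
    qed
  qed
  moreover have "g z \<noteq> 0" if "z \<in> cball 0 R" for z
    using that finZ L0 unfolding g_def by (auto simp: Z_def)
  ultimately have "circle_degree R g 0"
    by (rule circle_degree_nonzero_on_cball)
  moreover have "circle_degree R (\<lambda>z. \<Prod>q\<in>Z. L q z) (\<Sum>q\<in>Z. if norm (b q) < norm (a q) then 1 else -1)"
    unfolding L_def using sphereZ ab by (intro circle_degree_prod R finZ circle_degree_affine) (auto simp: Z_def)
  ultimately have "circle_degree R (\<lambda>z. g z * (\<Prod>q\<in>Z. L q z)) (0 + (\<Sum>q\<in>Z. if norm (b q) < norm (a q) then 1 else -1))"
    by (rule circle_degree_mult[OF R])
  \<comment> \<open>All zeros are interior, so on the circle \<open>g\<close> times the product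
    gives back \<open>f\<close>.\<close>
  then have "circle_degree R f (\<Sum>q\<in>Z. if norm (b q) < norm (a q) then 1 else -1)"
    by (rule circle_degree_cong) (use finZ L0 sphereZ in \<open>force simp: g_def\<close>)+
  moreover have "circle_degree R f 1"
    by (intro circle_degree_outward R out continuous_on_subset[OF cont]) auto
  ultimately show "(\<Sum>p | p \<in> cball 0 R \<and> f p = 0. if norm (b p) < norm (a p) then 1 else -1) = (1::int)"
    using circle_degree_unique[OF R] unfolding Z_def by blast
qed

text \<open>The index sum is transported to \<open>real ^ 2\<close> through the isometry
  \<open>J\<close> and its inverse \<open>K\<close>; the comparison of \<open>norm b\<close> with
  \<open>norm a\<close> becomes the sign of the Jacobian determinant.\<close>

theorem sum_sgn_det_eq_1:
  fixes F :: "real ^ 2 \<Rightarrow> real ^ 2" and A :: "real ^ 2 \<Rightarrow> real ^ 2 ^ 2"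
  assumes R: "R > 0" and cont: "continuous_on (cball 0 R) F"
    and out: "\<And>x. norm x = R \<Longrightarrow> F x \<bullet> x > 0"
    and der: "\<And>p. norm p \<le> R \<Longrightarrow> F p = 0 \<Longrightarrow> (F has_derivative (*v) (A p)) (at p)"
    and det: "\<And>p. norm p \<le> R \<Longrightarrow> F p = 0 \<Longrightarrow> det (A p) \<noteq> 0"
  shows "finite {p. norm p \<le> R \<and> F p = 0}"
    and "(\<Sum>p | norm p \<le> R \<and> F p = 0. if det (A p) > 0 then 1 else -1) = (1::int)"
proof -
  define J :: "complex \<Rightarrow> real ^ 2" where "J z = vector [Re z, Im z]" for z
  define K :: "real ^ 2 \<Rightarrow> complex" where "K x = Complex (x $ 1) (x $ 2)" for x
  define f where "f z = K (F (J z))" for z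
  \<comment> \<open>These are the Wirtinger coefficients of the matrix \<open>A (J z)\<close>, the
    linear and the antilinear part of the corresponding map of the complex plane.\<close>
  define a where "a z = Complex (A (J z) $ 1 $ 1 + A (J z) $ 2 $ 2) (A (J z) $ 2 $ 1 - A (J z) $ 1 $ 2) / 2" for z
  define b where "b z = Complex (A (J z) $ 1 $ 1 - A (J z) $ 2 $ 2) (A (J z) $ 2 $ 1 + A (J z) $ 1 $ 2) / 2" for z
  have JK [simp]: "J (K x) = x" for x by (simp add: J_def K_def vec_eq_iff forall_2)
  have KJ [simp]: "K (J z) = z" for z by (simp add: J_def K_def complex_eq_iff)
  have K0 [simp]: "K x = 0 \<longleftrightarrow> x = 0" for x by (simp add: K_def complex_eq_iff vec_eq_iff forall_2)
  have norm_J [simp]: "norm (J z) = norm z" for z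
    by (simp add: J_def norm_vec_def L2_set_def sum_2 cmod_def)
  have "linear J"
    by (rule linearI) (simp_all add: J_def vec_eq_iff forall_2)
  then have blJ: "bounded_linear J" by (rule linear_conv_bounded_linear[THEN iffD1])
  have "linear K"
    by (rule linearI) (simp_all add: K_def complex_eq_iff)
  then have blK: "bounded_linear K" by (rule linear_conv_bounded_linear[THEN iffD1])
  have KA: "K (A (J p) *v J w) = a p * w + b p * cnj w" for p w
    by (simp add: K_def J_def a_def b_def complex_eq_iff matrix_vector_mult_def sum_2 field_simps)
  have det_ab: "(norm (a p))\<^sup>2 - (norm (b p))\<^sup>2 = det (A (J p))" for p
    by (simp add: a_def b_def cmod_power2 det_2 norm_divide power_divide) (simp add: power2_eq_square field_simps)
  have ab_iff: "norm (b p) < norm (a p) \<longleftrightarrow> det (A (J p)) > 0" for p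
    using power_strict_mono[of "norm (b p)" "norm (a p)" 2] power_mono[of "norm (a p)" "norm (b p)" 2]
    unfolding det_ab[symmetric] by (smt (verit) norm_ge_zero zero_less_numeral)
  have f_cont: "continuous_on (cball 0 R) f"
    unfolding f_def
    by (intro continuous_on_compose2[OF cont] bounded_linear.continuous_on[OF blK] 
          bounded_linear.continuous_on[OF blJ] continuous_on_id) auto
  have f_out: "Re (f z * cnj z) > 0" if "z \<in> sphere 0 R" for z
    using out[of "J z", unfolded norm_J] that by (simp add: f_def K_def J_def inner_vec_def sum_2)
  have f_der: "(f has_derivative (\<lambda>w. a p * w + b p * cnj w)) (at p)" if "p \<in> cball 0 R" "f p = 0" for p
  proof -
    have "(F has_derivative (*v) (A (J p))) (at (J p))"
      using der[of "J p"] that by (simp add: f_def)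
    then have "((\<lambda>z. F (J z)) has_derivative (\<lambda>w. A (J p) *v J w)) (at p)"
      by (rule has_derivative_compose[OF bounded_linear_imp_has_derivative[OF blJ], of F])
    then show ?thesis
      unfolding f_def KA[symmetric] by (rule bounded_linear.has_derivative[OF blK])
  qed
  have f_ab: "norm (a p) \<noteq> norm (b p)" if "p \<in> cball 0 R" "f p = 0" for p
    using det[of "J p"] that det_ab[of p] by (auto simp: f_def)
  have zeros: "{p. norm p \<le> R \<and> F p = 0} = J ` {p \<in> cball 0 R. f p = 0}"
  proof (intro set_eqI iffI)
    fix p assume "p \<in> {p. norm p \<le> R \<and> F p = 0}"
    then show "p \<in> J ` {p \<in> cball 0 R. f p = 0}"
      using norm_J[of "K p"] by (intro image_eqI[of _ _ "K p"]) (simp_all add: f_def)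
  qed (auto simp: f_def)
  have inj: "inj_on J S" for S by (rule inj_on_inverseI[of _ K]) simp
  note main = sum_of_indices_eq_1[OF R f_cont f_out f_der f_ab]
  show "finite {p. norm p \<le> R \<and> F p = 0}"
    unfolding zeros by (intro finite_imageI main(1))
  show "(\<Sum>p | norm p \<le> R \<and> F p = 0. if det (A p) > 0 then 1 else -1) = (1::int)"
    using main(2) unfolding zeros sum.reindex[OF inj] o_def ab_iff .
qed

section \<open>Partial derivatives and their symmetry\<close>

lemma smooth2_differentiable: "smooth2 f \<Longrightarrow> f differentiable (at x)"
  by (erule smooth2.cases) simp

lemma smooth2_pd: "smooth2 f \<Longrightarrow> smooth2 (pd f i)"
  by (erule smooth2.cases) simp

lemma pd_eqI: "(f has_derivative f') (at x) \<Longrightarrow> pd f i x = f' (axis i 1)"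
  unfolding pd_def by (simp add: frechet_derivative_at[symmetric])

lemma has_derivative_grad:
  assumes "f differentiable (at x)"
  shows "(f has_derivative (\<lambda>h. grad f x \<bullet> h)) (at x)"
proof -
  let ?D = "frechet_derivative f (at x)"
  have D: "(f has_derivative ?D) (at x)" using assms by (simp add: frechet_derivative_works)
  then have lin: "linear ?D" by (rule has_derivative_linear)
  have "?D h = grad f x \<bullet> h" for h
  proof -
    have "h = h $ 1 *\<^sub>R axis 1 1 + h $ 2 *\<^sub>R axis 2 1"
      by (simp add: vec_eq_iff forall_2 axis_def)
    then have "?D h = ?D (h $ 1 *\<^sub>R axis 1 1 + h $ 2 *\<^sub>R axis 2 1)" by simp
    also have "\<dots> = grad f x \<bullet> h"
      by (simp add: linear_add[OF lin] linear_scale[OF lin] grad_def pd_def inner_vec_def sum_2)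
    finally show ?thesis .
  qed
  then show ?thesis using D by presburger
qed

lemma has_real_derivative_along_line:
  assumes "f differentiable (at (x + t *\<^sub>R v))"
  shows "((\<lambda>s. f (x + s *\<^sub>R v)) has_real_derivative grad f (x + t *\<^sub>R v) \<bullet> v) (at t)"
proof -
  have "((\<lambda>s. x + s *\<^sub>R v) has_derivative (\<lambda>s. s *\<^sub>R v)) (at t)"
    by (auto intro!: derivative_eq_intros)
  from has_derivative_compose[OF this has_derivative_grad[OF assms]]
  show ?thesis by (simp add: has_field_derivative_def mult.commute[of _ "grad f (x + t *\<^sub>R v) \<bullet> v"] mult_commute_abs)
qed

lemma grad_inner_axis [simp]: "grad f x \<bullet> axis i 1 = pd f i x"
  by (simp add: grad_def inner_axis)

section \<open>Equality of mixed second partial derivatives\<close>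

text \<open>The mean value theorem is used twice, first in direction \<open>i\<close> and then in
  direction \<open>j\<close>. The left side is symmetric in \<open>i\<close> and \<open>j\<close>,
  whereas the right side records the order of differentiation.\<close>

lemma second_difference_mvt:
  assumes f: "\<And>x. f differentiable (at x)" and pdf: "\<And>x. pd f i differentiable (at x)" and h: "h > 0"
  shows "\<exists>s t. 0 < s \<and> s < h \<and> 0 < t \<and> t < h \<and>
    f (x + h *\<^sub>R axis i 1 + h *\<^sub>R axis j 1) - f (x + h *\<^sub>R axis i 1) - f (x + h *\<^sub>R axis j 1) + f x
      = h\<^sup>2 * pd (pd f i) j (x + s *\<^sub>R axis i 1 + t *\<^sub>R axis j 1)"
proof -
  let ?ei = "axis i 1 :: pt" and ?ej = "axis j 1 :: pt"
  \<comment> \<open>The increment of \<open>\<phi>\<close> from 0 to \<open>h\<close> is the second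
    difference.\<close>
  define \<phi> where "\<phi> s = f ((x + h *\<^sub>R ?ej) + s *\<^sub>R ?ei) - f (x + s *\<^sub>R ?ei)" for s
  have "(\<phi> has_real_derivative pd f i ((x + h *\<^sub>R ?ej) + s *\<^sub>R ?ei) - pd f i (x + s *\<^sub>R ?ei)) (at s)" for s
    unfolding \<phi>_def
    using has_real_derivative_along_line[OF f, of "x + h *\<^sub>R ?ej" ?ei s]
      has_real_derivative_along_line[OF f, of x ?ei s]
    by (intro DERIV_diff) simp_all
  then obtain s where s: "0 < s" "s < h"
    and 1: "\<phi> h - \<phi> 0 = h * (pd f i ((x + h *\<^sub>R ?ej) + s *\<^sub>R ?ei) - pd f i (x + s *\<^sub>R ?ei))"
    using MVT2[OF h, of \<phi> "\<lambda>s. pd f i ((x + h *\<^sub>R ?ej) + s *\<^sub>R ?ei) - pd f i (x + s *\<^sub>R ?ei)"] by auto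
  have "((\<lambda>t. pd f i ((x + s *\<^sub>R ?ei) + t *\<^sub>R ?ej)) has_real_derivative
      pd (pd f i) j ((x + s *\<^sub>R ?ei) + t *\<^sub>R ?ej)) (at t)" for t
    using has_real_derivative_along_line[OF pdf, of "x + s *\<^sub>R ?ei" ?ej t] by simp
  then obtain t where t: "0 < t" "t < h"
    and 2: "pd f i ((x + s *\<^sub>R ?ei) + h *\<^sub>R ?ej) - pd f i ((x + s *\<^sub>R ?ei) + 0 *\<^sub>R ?ej)
      = h * pd (pd f i) j ((x + s *\<^sub>R ?ei) + t *\<^sub>R ?ej)"
    using MVT2[OF h, of "\<lambda>t. pd f i ((x + s *\<^sub>R ?ei) + t *\<^sub>R ?ej)"
        "\<lambda>t. pd (pd f i) j ((x + s *\<^sub>R ?ei) + t *\<^sub>R ?ej)"] by auto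
  show ?thesis
    using s t 1 2 by (intro exI[of _ s] exI[of _ t]) (simp add: \<phi>_def add_ac power2_eq_square)
qed

text \<open>Both mixed derivatives, taken at suitable points near \<open>x\<close>, equal the same
  second difference quotient with step \<open>1 / real (Suc n)\<close>. The points tend to
  \<open>x\<close>, and continuity gives equality there.\<close>

lemma pd_commute:
  assumes f: "\<And>x. f differentiable (at x)" and pdf: "\<And>k x. pd f k differentiable (at x)"
    and cont: "\<And>k l. continuous_on UNIV (pd (pd f k) l)"
  shows "pd (pd f i) j x = pd (pd f j) i x"
proof -
  let ?ei = "axis i 1 :: pt" and ?ej = "axis j 1 :: pt"
  have lim: "(\<lambda>n. pd (pd f k) l (x + s n *\<^sub>R u + t n *\<^sub>R v)) \<longlonglongrightarrow> pd (pd f k) l x"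
    if st: "\<And>n::nat. 0 < s n \<and> s n < 1 / real (Suc n) \<and> 0 < t n \<and> t n < 1 / real (Suc n)" for k l s t u v
  proof -
    have "s \<longlonglongrightarrow> 0" "t \<longlonglongrightarrow> 0"
      by (rule tendsto_sandwich[OF _ _ tendsto_const LIMSEQ_Suc[OF lim_1_over_n]];
          use st less_imp_le in \<open>auto intro!: always_eventually\<close>)+
    then have "(\<lambda>n. x + s n *\<^sub>R u + t n *\<^sub>R v) \<longlonglongrightarrow> x + 0 *\<^sub>R u + 0 *\<^sub>R v"
      by (intro tendsto_intros)
    then show ?thesis
      using continuous_on_tendsto_compose[OF cont] by fastforce
  qed
  let ?D = "\<lambda>h. f (x + h *\<^sub>R ?ei + h *\<^sub>R ?ej) - f (x + h *\<^sub>R ?ei) - f (x + h *\<^sub>R ?ej) + f x"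
  have "\<exists>s t. 0 < s \<and> s < h \<and> 0 < t \<and> t < h \<and> ?D h = h\<^sup>2 * pd (pd f i) j (x + s *\<^sub>R ?ei + t *\<^sub>R ?ej)"
    if "h > 0" for h
    using second_difference_mvt[OF f pdf that] by blast
  then have "\<forall>n. \<exists>s t. 0 < s \<and> s < 1 / real (Suc n) \<and> 0 < t \<and> t < 1 / real (Suc n) \<and>
      ?D (1 / real (Suc n)) = (1 / real (Suc n))\<^sup>2 * pd (pd f i) j (x + s *\<^sub>R ?ei + t *\<^sub>R ?ej)"
    by simp
  then obtain s t where st: "\<And>n. 0 < s n \<and> s n < 1 / real (Suc n) \<and> 0 < t n \<and> t n < 1 / real (Suc n)"
    and 1: "\<And>n. ?D (1 / real (Suc n)) = (1 / real (Suc n))\<^sup>2 * pd (pd f i) j (x + s n *\<^sub>R ?ei + t n *\<^sub>R ?ej)"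
    by metis
  have "\<exists>s t. 0 < s \<and> s < h \<and> 0 < t \<and> t < h \<and> ?D h = h\<^sup>2 * pd (pd f j) i (x + s *\<^sub>R ?ej + t *\<^sub>R ?ei)"
    if "h > 0" for h
    using second_difference_mvt[OF f pdf that, of x j i] by (simp add: algebra_simps)
  then have "\<forall>n. \<exists>s t. 0 < s \<and> s < 1 / real (Suc n) \<and> 0 < t \<and> t < 1 / real (Suc n) \<and>
      ?D (1 / real (Suc n)) = (1 / real (Suc n))\<^sup>2 * pd (pd f j) i (x + s *\<^sub>R ?ej + t *\<^sub>R ?ei)"
    by simp
  then obtain s' t' where st': "\<And>n. 0 < s' n \<and> s' n < 1 / real (Suc n) \<and> 0 < t' n \<and> t' n < 1 / real (Suc n)"
    and 2: "\<And>n. ?D (1 / real (Suc n)) = (1 / real (Suc n))\<^sup>2 * pd (pd f j) i (x + s' n *\<^sub>R ?ej + t' n *\<^sub>R ?ei)"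
    by metis
  have "pd (pd f i) j (x + s n *\<^sub>R ?ei + t n *\<^sub>R ?ej) = pd (pd f j) i (x + s' n *\<^sub>R ?ej + t' n *\<^sub>R ?ei)" for n
    using 1[of n] 2[of n] by simp
  then show ?thesis
    using lim[OF st, of i j ?ei ?ej] lim[OF st', of j i ?ej ?ei] LIMSEQ_unique by auto
qed

lemma smooth2_continuous: "smooth2 f \<Longrightarrow> continuous_on S f"
  by (intro continuous_at_imp_continuous_on ballI differentiable_imp_continuous_within smooth2_differentiable)

lemma smooth2_pd_commute: "smooth2 f \<Longrightarrow> pd (pd f i) j x = pd (pd f j) i x"
  by (intro pd_commute smooth2_differentiable smooth2_continuous smooth2_pd)

section \<open>The time delay function\<close>

lemma has_derivative_norm_diff_square:
  fixes x y :: "'a::real_inner"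
  shows "((\<lambda>x. (1/2) * (norm (x - y))\<^sup>2) has_derivative (\<lambda>h. (x - y) \<bullet> h)) (at x)"
  unfolding power2_norm_eq_inner
  by (auto intro!: derivative_eq_intros simp: inner_commute)

lemma has_derivative_Tdelay:
  assumes "psi differentiable (at x)"
  shows "(Tdelay psi y has_derivative (\<lambda>h. (lensmap psi x - y) \<bullet> h)) (at x)"
  unfolding Tdelay_def
  using has_derivative_diff[OF has_derivative_norm_diff_square has_derivative_grad[OF assms]]
  by (simp add: lensmap_def algebra_simps)

lemma grad_Tdelay:
  assumes "psi differentiable (at x)"
  shows "grad (Tdelay psi y) x = lensmap psi x - y"
  by (simp add: grad_def pd_eqI[OF has_derivative_Tdelay[OF assms]] inner_axis vec_eq_iff)

context
  fixes psi :: "pt \<Rightarrow> real"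
  assumes smooth: "smooth2 psi"
begin

lemma Tdelay_differentiable: "Tdelay psi y differentiable (at x)"
  using has_derivative_Tdelay[OF smooth2_differentiable[OF smooth]] unfolding differentiable_def by blast

lemma images_eq: "images psi y = {x. lensmap psi x - y = 0}"
  by (simp add: images_def grad_Tdelay smooth2_differentiable[OF smooth])

lemma pd_Tdelay: "pd (Tdelay psi y) i = (\<lambda>x. x $ i - y $ i - pd psi i x)"
proof
  fix x
  have "pd (Tdelay psi y) i x = grad (Tdelay psi y) x $ i" by (simp add: grad_def)
  then show "pd (Tdelay psi y) i x = x $ i - y $ i - pd psi i x"
    by (simp add: grad_Tdelay smooth2_differentiable[OF smooth] lensmap_def) (simp add: grad_def)
qed

lemma has_derivative_pd_Tdelay:
  "(pd (Tdelay psi y) i has_derivative (\<lambda>h. ((mat 1 - hess psi x) *v h) $ i)) (at x)"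
proof -
  have "((\<lambda>x. x $ i - y $ i - pd psi i x) has_derivative (\<lambda>h. h $ i - grad (pd psi i) x \<bullet> h)) (at x)"
    by (auto intro!: derivative_eq_intros has_derivative_grad smooth2_differentiable smooth2_pd smooth
        bounded_linear_imp_has_derivative[OF bounded_linear_vec_nth])
  \<comment> \<open>Row \<open>i\<close> of \<open>hess\<close> holds the derivatives in direction
    \<open>i\<close> of all first partials, whereas the gradient of \<open>pd psi i\<close> fixes
    the inner index, so symmetry is used to match them.\<close>
  moreover have "h $ i - grad (pd psi i) x \<bullet> h = ((mat 1 - hess psi x) *v h) $ i" for h
    by (simp add: matrix_vector_mult_diff_rdistrib)
       (simp add: matrix_vector_mult_def hess_def grad_def inner_vec_def smooth2_pd_commute[OF smooth, of _ i])
  ultimately show ?thesis by (simp add: pd_Tdelay)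
qed

lemma has_derivative_lensmap:
  "((\<lambda>x. lensmap psi x - y) has_derivative (*v) (mat 1 - hess psi x)) (at x)"
proof -
  have "((\<lambda>x. \<chi> i. pd (Tdelay psi y) i x) has_derivative (\<lambda>h. \<chi> i. ((mat 1 - hess psi x) *v h) $ i)) (at x)"
    using has_derivative_pd_Tdelay
    by (subst has_derivative_componentwise_within) (auto simp: Basis_vec_def inner_axis)
  moreover have "(\<chi> i. pd (Tdelay psi y) i x) = lensmap psi x - y" for x
    using grad_Tdelay[OF smooth2_differentiable[OF smooth]] by (simp add: grad_def)
  ultimately show ?thesis by simp
qed

lemma hess_Tdelay: "hess (Tdelay psi y) x = mat 1 - hess psi x"
proof -
  have "pd (pd (Tdelay psi y) j) i x = (mat 1 - hess psi x) $ j $ i" for i j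
    by (simp add: pd_eqI[OF has_derivative_pd_Tdelay] matrix_vector_mult_basis column_def)
  moreover have "hess psi x $ j $ i = hess psi x $ i $ j" for i j
    by (simp add: hess_def smooth2_pd_commute[OF smooth, of i j])
  ultimately show ?thesis
    by (simp add: vec_eq_iff hess_def mat_def)
qed

text \<open>Together with \<open>hess_Tdelay\<close> this identifies the Jacobian of the lens map
  with the Hessian of every time delay, so images of a non-caustic point are nondegenerate critical
  points.\<close>

lemma jac_lensmap: "jac (lensmap psi) x = mat 1 - hess psi x"
  using frechet_derivative_at[OF has_derivative_lensmap[of 0 x], symmetric] by (simp add: jac_def)

section \<open>Convexity and growth of the time delay far out\<close>

text \<open>The two assumptions say that both eigenvalues of the symmetric matrix are positive;
  hence so are trace and determinant, and completing the square bounds the form.\<close>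

lemma hess_form_nonneg:
  assumes "1 - kappa psi x + sqrt (Gamma2 psi x) > 0" "1 - kappa psi x - sqrt (Gamma2 psi x) > 0"
  shows "((mat 1 - hess psi x) *v v) \<bullet> v \<ge> 0"
proof -
  define a b c where "a = 1 - pd (pd psi 1) 1 x" and "b = pd (pd psi 2) 1 x" and "c = 1 - pd (pd psi 2) 2 x"
  have G: "Gamma2 psi x = (1/4) * (a - c)\<^sup>2 + b\<^sup>2"
    by (simp add: Gamma2_def a_def b_def c_def power2_commute)
  have k: "1 - kappa psi x = (a + c) / 2"
    by (simp add: kappa_def a_def c_def field_simps)
  have "Gamma2 psi x \<ge> 0" unfolding G by simp
  have pos: "(a + c) / 2 > 0" using assms unfolding k by linarith
  \<comment> \<open>The square of half the trace minus \<open>Gamma2\<close> is the determinant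
    \<open>a * c - b\<^sup>2\<close>.\<close>
  have "(sqrt (Gamma2 psi x))\<^sup>2 < ((a + c) / 2)\<^sup>2"
    using assms(2) \<open>Gamma2 psi x \<ge> 0\<close> unfolding k by (intro power_strict_mono) auto
  then have "Gamma2 psi x < ((a + c) / 2)\<^sup>2"
    using \<open>Gamma2 psi x \<ge> 0\<close> by simp
  then have ac: "a * c > b\<^sup>2"
    unfolding G by (simp add: power2_eq_square field_simps)
  then have "a * c > 0" using zero_le_power2[of b] by linarith
  then have a: "a > 0" using pos by (auto simp: zero_less_mult_iff)
  have "pd (pd psi 1) 2 x = b"
    using smooth2_pd_commute[OF smooth, of 1 2 x] by (simp add: b_def)
  then have "((mat 1 - hess psi x) *v v) \<bullet> v = a * (v $ 1)\<^sup>2 - 2 * b * v $ 1 * v $ 2 + c * (v $ 2)\<^sup>2"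
    by (simp add: matrix_vector_mult_def inner_vec_def sum_2 hess_def mat_def a_def b_def c_def
        power2_eq_square algebra_simps)
  moreover have "a * (a * (v $ 1)\<^sup>2 - 2 * b * v $ 1 * v $ 2 + c * (v $ 2)\<^sup>2)
      = (a * v $ 1 - b * v $ 2)\<^sup>2 + (a * c - b\<^sup>2) * (v $ 2)\<^sup>2"
    by (simp add: power2_eq_square algebra_simps)
  moreover have "\<dots> \<ge> 0" using ac by simp
  ultimately show ?thesis using a by (metis zero_le_mult_iff not_less)
qed

text \<open>On a ray the time delay ends above its maximum on a fixed circle, so its derivative
  along the ray is positive at some point beyond that circle. Convexity beyond the circle keeps it
  positive up to \<open>x\<close>.\<close>

lemma gradient_outward:
  assumes "isolated_td psi y"
  shows "\<exists>R. \<forall>x. norm x \<ge> R \<longrightarrow> (lensmap psi x - y) \<bullet> x > 0"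
proof -
  let ?T = "Tdelay psi y"
  obtain R0 where R0: "\<And>x. norm x \<ge> R0 \<Longrightarrow>
      1 - kappa psi x + sqrt (Gamma2 psi x) > 0 \<and> 1 - kappa psi x - sqrt (Gamma2 psi x) > 0"
    using assms unfolding isolated_td_def by blast
  define R where "R = max R0 1"
  have R: "R > 0" by (simp add: R_def)
  have T_cont: "continuous_on S ?T" for S
    by (intro continuous_at_imp_continuous_on ballI differentiable_imp_continuous_within Tdelay_differentiable)
  obtain M where M: "\<And>x. norm x = R \<Longrightarrow> ?T x \<le> M"
  proof -
    have "compact (?T ` sphere 0 R)" by (intro compact_continuous_image T_cont compact_sphere)
    then have "bdd_above (?T ` sphere 0 R)" by (intro bounded_imp_bdd_above compact_imp_bounded)
    then obtain M where "\<forall>t\<in>?T ` sphere 0 R. t \<le> M" unfolding bdd_above_def by blast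
    then show ?thesis by (intro that[of M]) simp
  qed
  have "\<forall>\<^sub>F x in at_infinity. ?T x > M"
    using assms unfolding isolated_td_def filterlim_at_top_dense by blast
  then obtain R1 where R1: "\<And>x. norm x \<ge> R1 \<Longrightarrow> ?T x > M"
    unfolding eventually_at_infinity by blast
  show ?thesis
  proof (intro exI[of _ "max R1 (R + 1)"] allI impI)
    \<comment> \<open>The bound \<open>R1\<close> puts \<open>?T x\<close> above the circle maximum,
      and \<open>R + 1\<close> makes \<open>x\<close> lie strictly outside the circle.\<close>
    fix x :: pt assume x: "norm x \<ge> max R1 (R + 1)"
    \<comment> \<open>The parameter at which the ray through \<open>x\<close> crosses the circle of
      radius \<open>R\<close>; the point \<open>x\<close> itself has parameter 1.\<close>
    define r where "r = R / norm x"
    have nx: "norm x > R" using x by simp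
    have "x \<noteq> 0" "norm x > 0" using R nx by auto
    then have r: "0 < r" "r < 1" and r_x: "r * norm x = R"
      using R nx unfolding r_def by (simp_all add: divide_less_eq_1_pos del: zero_less_norm_iff)
    have 1: "((\<lambda>t. ?T (t *\<^sub>R x)) has_real_derivative (lensmap psi (t *\<^sub>R x) - y) \<bullet> x) (at t)" for t
      using has_real_derivative_along_line[OF Tdelay_differentiable, of y 0 x t]
      by (simp add: grad_Tdelay[OF smooth2_differentiable[OF smooth]])
    have 2: "((\<lambda>t. (lensmap psi (t *\<^sub>R x) - y) \<bullet> x) has_real_derivative
        ((mat 1 - hess psi (t *\<^sub>R x)) *v x) \<bullet> x) (at t)" for t
    proof -
      have "((\<lambda>t. t *\<^sub>R x) has_derivative (\<lambda>t. t *\<^sub>R x)) (at t)"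
        by (auto intro!: derivative_eq_intros)
      from has_derivative_compose[OF this has_derivative_lensmap]
      have "((\<lambda>t. (lensmap psi (t *\<^sub>R x) - y) \<bullet> x) has_derivative
          (\<lambda>s. ((mat 1 - hess psi (t *\<^sub>R x)) *v (s *\<^sub>R x)) \<bullet> x)) (at t)"
        by (rule has_derivative_inner_left)
      then show ?thesis
        by (simp add: has_field_derivative_def scaleR_matrix_vector_assoc[symmetric] mult_commute_abs
            matrix_vector_mult_scaleR)
    qed
    obtain t where t: "r < t" "t < 1"
      and T: "?T (1 *\<^sub>R x) - ?T (r *\<^sub>R x) = (1 - r) * ((lensmap psi (t *\<^sub>R x) - y) \<bullet> x)"
      using MVT2[OF r(2), of "\<lambda>t. ?T (t *\<^sub>R x)", OF 1] by auto
    have "norm (r *\<^sub>R x) = R" using r r_x by simp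
    then have "?T (1 *\<^sub>R x) - ?T (r *\<^sub>R x) > 0"
      using M[of "r *\<^sub>R x"] R1[of x] x by simp
    then have "(lensmap psi (t *\<^sub>R x) - y) \<bullet> x > 0"
      unfolding T using r by (simp add: zero_less_mult_iff)
    also have "(lensmap psi (t *\<^sub>R x) - y) \<bullet> x \<le> (lensmap psi (1 *\<^sub>R x) - y) \<bullet> x"
    proof (rule DERIV_nonneg_imp_nondecreasing[where f = "\<lambda>t. (lensmap psi (t *\<^sub>R x) - y) \<bullet> x"])
      fix s assume s: "t \<le> s" "s \<le> 1"
      have "R = r * norm x" using r_x by simp
      also have "\<dots> \<le> norm (s *\<^sub>R x)" using s t r by (simp add: mult_right_mono)
      finally have "((mat 1 - hess psi (s *\<^sub>R x)) *v x) \<bullet> x \<ge> 0"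
        using R0[of "s *\<^sub>R x"] by (intro hess_form_nonneg) (auto simp: R_def)
      then show "\<exists>d. ((\<lambda>t. (lensmap psi (t *\<^sub>R x) - y) \<bullet> x) has_real_derivative d) (at s) \<and> 0 \<le> d"
        using 2 by blast
    qed (use t in simp)
    finally show "(lensmap psi x - y) \<bullet> x > 0" by simp
  qed
qed

section \<open>The signed count of images\<close>

lemma sum_sgn_images:
  assumes iso: "isolated_td psi y" and nc: "\<not> caustic psi y"
  shows "finite (images psi y)"
    and "(\<Sum>x\<in>images psi y. if det (mat 1 - hess psi x) > 0 then 1 else -1) = (1::int)"
proof -
  obtain R0 where R0: "\<And>x. norm x \<ge> R0 \<Longrightarrow> (lensmap psi x - y) \<bullet> x > 0"
    using gradient_outward[OF iso] by blast
  define R where "R = max R0 1"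
  have R: "R > 0" and out: "\<And>x. norm x \<ge> R \<Longrightarrow> (lensmap psi x - y) \<bullet> x > 0"
    using R0 by (auto simp: R_def)
  \<comment> \<open>An image outside the ball would give the inner product 0 where it is positive,
    so the ball contains all images.\<close>
  have im: "images psi y = {x. norm x \<le> R \<and> lensmap psi x - y = 0}"
    using out unfolding images_eq by (metis (lifting) inner_zero_left less_irrefl linorder_le_cases)
  have det: "det (mat 1 - hess psi x) \<noteq> 0" if "lensmap psi x - y = 0" for x
    using nc that by (auto simp: caustic_def jac_lensmap)
  have cont: "continuous_on (cball 0 R) (\<lambda>x. lensmap psi x - y)"
    by (intro continuous_at_imp_continuous_on ballI has_derivative_continuous[OF has_derivative_lensmap])
  note main = sum_sgn_det_eq_1[OF R cont out has_derivative_lensmap det]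
  show "finite (images psi y)" unfolding im by (rule main(1)) auto
  show "(\<Sum>x\<in>images psi y. if det (mat 1 - hess psi x) > 0 then 1 else -1) = (1::int)"
    unfolding im by (rule main(2)) auto
qed

section \<open>The global minimum of the time delay\<close>

text \<open>Outside a large ball the time delay exceeds its value at the origin, so its minimum over
  the ball is global, and there the gradient vanishes.\<close>

lemma Tdelay_attains_minimum:
  assumes iso: "isolated_td psi y"
  obtains m where "m \<in> images psi y" "\<And>x. Tdelay psi y m \<le> Tdelay psi y x"
proof -
  let ?T = "Tdelay psi y"
  have "\<forall>\<^sub>F x in at_infinity. ?T x > ?T 0"
    using iso unfolding isolated_td_def filterlim_at_top_dense by blast
  then obtain B where B: "\<And>x. norm x \<ge> B \<Longrightarrow> ?T x > ?T 0"
    unfolding eventually_at_infinity by blast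
  \<comment> \<open>The absolute value ensures that the ball contains the origin, the point of
    comparison, even if \<open>B\<close> is negative.\<close>
  have "continuous_on (cball 0 \<bar>B\<bar>) ?T"
    by (intro continuous_at_imp_continuous_on ballI differentiable_imp_continuous_within Tdelay_differentiable)
  then have "\<exists>m\<in>cball 0 \<bar>B\<bar>. \<forall>x\<in>cball 0 \<bar>B\<bar>. ?T m \<le> ?T x"
    by (intro continuous_attains_inf) auto
  then obtain m where m: "\<And>x. x \<in> cball 0 \<bar>B\<bar> \<Longrightarrow> ?T m \<le> ?T x"
    by blast
  have min: "?T m \<le> ?T x" for x
  proof (cases "norm x \<le> \<bar>B\<bar>")
    case False
    then have "?T 0 < ?T x" by (intro B) linarith
    then show ?thesis using m[of 0] by simp
  qed (use m in simp)
  have "(\<lambda>h. (lensmap psi m - y) \<bullet> h) = (\<lambda>h. 0)"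
    using differential_zero_maxmin[OF _ open_UNIV has_derivative_Tdelay[OF smooth2_differentiable[OF smooth]]] min
    by blast
  then have "(lensmap psi m - y) \<bullet> (lensmap psi m - y) = 0" by metis
  then have "m \<in> images psi y" by (simp add: images_eq)
  then show ?thesis using that min by blast
qed

text \<open>The second derivative test along a coordinate axis: were the diagonal entry of the
  Hessian of the time delay negative, its vanishing first derivative would turn negative just beyond
  \<open>x\<close>, and smaller values would follow.\<close>

lemma hess_diagonal_nonneg_at_minimum:
  assumes crit: "x \<in> images psi y" and min: "\<And>z. Tdelay psi y x \<le> Tdelay psi y z"
  shows "pd (pd psi i) i x \<le> 1"
proof (rule ccontr)
  let ?T = "Tdelay psi y"
  let ?g = "\<lambda>t. pd ?T i (x + t *\<^sub>R axis i 1)"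
  assume "\<not> pd (pd psi i) i x \<le> 1"
  moreover have "pd (pd ?T i) i x = 1 - pd (pd psi i) i x"
    using hess_Tdelay[of y x] by (simp add: vec_eq_iff hess_def mat_def)
  ultimately have neg: "pd (pd ?T i) i x < 0" by simp
  have "pd ?T i differentiable (at z)" for z
    using has_derivative_pd_Tdelay unfolding differentiable_def by blast
  from has_real_derivative_along_line[OF this, of x "axis i 1" 0]
  have "(?g has_real_derivative pd (pd ?T i) i x) (at 0)" by simp
  from DERIV_neg_dec_right[OF this neg]
  obtain d where d: "d > 0" "\<And>h. 0 < h \<Longrightarrow> h < d \<Longrightarrow> ?g h < ?g 0" by auto
  have "?g 0 = 0"
    using crit unfolding images_def by (simp add: grad_def vec_eq_iff)
  have "((\<lambda>t. ?T (x + t *\<^sub>R axis i 1)) has_real_derivative ?g t) (at t)" for t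
    using has_real_derivative_along_line[OF Tdelay_differentiable, of y x "axis i 1" t] by simp
  moreover have "0 < d / 2" using d by simp
  ultimately obtain t where "0 < t" "t < d / 2"
    and "?T (x + (d/2) *\<^sub>R axis i 1) - ?T (x + 0 *\<^sub>R axis i 1) = (d/2 - 0) * ?g t"
    using MVT2[of 0 "d / 2" "\<lambda>t. ?T (x + t *\<^sub>R axis i 1)" ?g] by blast
  moreover have "?g t < 0" using d(2)[of t] \<open>?g 0 = 0\<close> calculation by simp
  moreover have "(d/2 - 0) * ?g t < 0" using calculation(4) d(1) by (simp add: mult_less_0_iff)
  ultimately show False using min[of "x + (d/2) *\<^sub>R axis i 1"] by simp
qed

end

section \<open>Counting images\<close>

text \<open>The sum is the number of positive points minus the number of negative ones, so the
  former exceeds the latter by one. In particular the total is odd.\<close>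

lemma sum_signs_eq_1:
  assumes fin: "finite S" and sum: "(\<Sum>x\<in>S. if P x then 1 else -1) = (1::int)"
  shows "card S = 2 * card {x\<in>S. \<not> P x} + 1"
proof -
  have "(\<Sum>x\<in>S. if P x then 1 else -1) = int (card {x\<in>S. P x}) - int (card {x\<in>S. \<not> P x})"
    using fin by (simp add: sum.If_cases Int_def)
  moreover have "card S = card {x\<in>S. P x} + card {x\<in>S. \<not> P x}"
    using fin by (subst card_Un_disjoint[symmetric]) (auto intro: arg_cong[of _ _ card])
  ultimately show ?thesis using sum by simp
qed

lemma at_least_three_iff: "finite S \<Longrightarrow> at_least_three S \<longleftrightarrow> card S \<ge> 3"
  unfolding at_least_three_def by (metis card_mono obtain_subset_with_card_n)

theorem theorem2p3:
  fixes psi :: "real ^ 2 \<Rightarrow> real"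
  assumes smooth: "smooth2 psi"
    and iso: "\<And>y. \<not> caustic psi y \<Longrightarrow> isolated_td psi y"
  shows "(\<forall>y. \<not> caustic psi y \<and> (\<exists>a b. a \<in> images psi y \<and> b \<in> images psi y \<and> a \<noteq> b)
            \<longrightarrow> at_least_three (images psi y) \<and> (\<exists>x0. det (hess (Tdelay psi y) x0) < 0))
       \<and> (\<forall>y x0. det (hess (Tdelay psi y) x0) < 0 \<and> \<not> caustic psi (lensmap psi x0)
            \<longrightarrow> at_least_three (images psi (lensmap psi x0)))
       \<and> (\<forall>x0. kappa psi x0 > 1 \<and> \<not> caustic psi (lensmap psi x0)
            \<longrightarrow> at_least_three (images psi (lensmap psi x0)))"
proof -
  let ?H = "\<lambda>x. mat 1 - hess psi x"
  let ?S = "\<lambda>y. {x \<in> images psi y. \<not> det (?H x) > 0}"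
  have fin: "finite (images psi y)" and card: "card (images psi y) = 2 * card (?S y) + 1"
    if "\<not> caustic psi y" for y
  proof -
    show "finite (images psi y)" by (rule sum_sgn_images(1)[OF smooth iso[OF that] that])
    then show "card (images psi y) = 2 * card (?S y) + 1"
      by (rule sum_signs_eq_1[OF _ sum_sgn_images(2)[OF smooth iso[OF that] that]])
  qed
  have three: "at_least_three (images psi y)" and saddle: "?S y \<noteq> {}"
    if nc: "\<not> caustic psi y" and ab: "a \<in> images psi y" "b \<in> images psi y" "a \<noteq> b" for y a b
  proof -
    \<comment> \<open>An odd number that is at least 2 is at least 3, and then the number of saddles
      is not 0.\<close>
    have "card {a, b} \<le> card (images psi y)"
      using ab fin[OF nc] by (intro card_mono) auto
    then show "at_least_three (images psi y)" "?S y \<noteq> {}"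
      using ab card[OF nc] fin[OF nc] by (auto simp: at_least_three_iff simp del: Collect_empty_eq)
  qed
  have self: "x \<in> images psi (lensmap psi x)" for x
    by (simp add: images_eq[OF smooth])
  have "\<exists>x0. det (hess (Tdelay psi y) x0) < 0"
    if nc: "\<not> caustic psi y" and ab: "a \<in> images psi y" "b \<in> images psi y" "a \<noteq> b" for y a b
  proof -
    obtain x where "x \<in> images psi y" "\<not> det (?H x) > 0" using saddle[OF nc ab] by blast
    \<comment> \<open>The point found only has a determinant that is not positive; being non-caustic
      excludes 0.\<close>
    moreover from this nc have "det (?H x) \<noteq> 0"
      by (auto simp: caustic_def jac_lensmap[OF smooth] images_eq[OF smooth])
    ultimately show ?thesis by (auto simp: hess_Tdelay[OF smooth] intro!: exI[of _ x])
  qed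
  moreover have neg: "at_least_three (images psi (lensmap psi x0))"
    if "det (?H x0) < 0" "\<not> caustic psi (lensmap psi x0)" for x0
  proof -
    \<comment> \<open>Every point is an image of its own value under the lens map, so
      \<open>x0\<close> is counted as a saddle.\<close>
    have "x0 \<in> ?S (lensmap psi x0)" using that(1) self by simp
    then have "card (?S (lensmap psi x0)) > 0"
      using fin[OF that(2)] by (auto simp: card_gt_0_iff simp del: Collect_empty_eq)
    then show ?thesis using card[OF that(2)] fin[OF that(2)] by (simp add: at_least_three_iff)
  qed
  moreover have "at_least_three (images psi (lensmap psi x0))"
    if k: "kappa psi x0 > 1" and nc: "\<not> caustic psi (lensmap psi x0)" for x0
  proof -
    obtain m where m: "m \<in> images psi (lensmap psi x0)"
      "\<And>x. Tdelay psi (lensmap psi x0) m \<le> Tdelay psi (lensmap psi x0) x"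
      using Tdelay_attains_minimum[OF smooth iso[OF nc]] by blast
    \<comment> \<open>At the minimum both diagonal second derivatives of \<open>psi\<close> are at
      most 1, hence so is their mean \<open>kappa psi m\<close>, whereas \<open>kappa psi x0\<close>
      exceeds 1.\<close>
    have "m \<noteq> x0"
      using hess_diagonal_nonneg_at_minimum[OF smooth m, of 1] hess_diagonal_nonneg_at_minimum[OF smooth m, of 2] k
      by (auto simp: kappa_def)
    then show ?thesis using three[OF nc m(1) self] by simp
  qed
  \<comment> \<open>The Hessian of the time delay is the same for all \<open>y\<close>, so in the
    converse the \<open>y\<close> in the determinant may differ from
    \<open>lensmap psi x0\<close>.\<close>
  ultimately show ?thesis
    using three by (auto simp: hess_Tdelay[OF smooth])
qed

end
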